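(* Let $z^*=(x^*,y^* )\in F$. Then $z^*$ is a $T^B$-stationary point of the problem $\min\{f(z): z\in F\}$ if and only if $$\begin{cases}\nabla_i f(z^* )=0\ \ \forall i\in\Gamma^*\setminus\{\gamma_{x^*}\}&\text{if }|\Gamma_1^*|=s\text{ and }|\Gamma_2^*|=t,\\ \nabla_i f(z^* )=0\ \ \forall i\in(\Gamma_1^*\setminus\{\gamma_{x^*}\})\cup I_2&\text{if }|\Gamma_1^*|=s\text{ and }|\Gamma_2^*|<t,\\ \nabla_i f(z^* )=0\ \ \forall i\in\{\gamma_{x^*}+1,\dots,m\}\cup\Gamma_2^*&\text{if }|\Gamma_1^*|<s\text{ and }|\Gamma_2^*|=t,\\ \nabla_i f(z^* )=0\ \ \forall i\in I\text{ with }i>\gamma_{x^*}&\text{if }|\Gamma_1^*|<s\text{ and }|\Gamma_2^*|<t.\end{cases}$$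
   Context: $l,m,n,s,t$ are positive integers with $s<m$, $t<n$; $\mathscr{A}=(a_{ijk})\in\mathbb{R}^{l\times m\times n}$ and $b\in\mathbb{R}^l$ are given. For $x\in\mathbb{R}^m$, $y\in\mathbb{R}^n$, $\mathscr{A}xy\in\mathbb{R}^l$ has entries $(\mathscr{A}xy)_i=\sum_{j,k}a_{ijk}x_jy_k$, and $f(z)=f(x,y)=\frac12\|\mathscr{A}xy-b\|^2$ for $z=(x,y)\in\mathbb{R}^{m+n}$. $I=\{1,\dots,m+n\}$, $I_1=\{1,\dots,m\}$, $I_2=\{m+1,\dots,m+n\}$; coordinates of $y$ are indexed by $I_2$. $\nabla_i f(z)$ is the $i$-th component of $\nabla f(z)$. $\Gamma^*=\{i\in I:z^*_i\neq0\}$, $\Gamma^*_1=\Gamma^*\cap I_1$, $\Gamma_2^*=\Gamma^*\cap I_2$. $\|\cdot\|_0$ counts nonzero entries. For $x\ne0$, $\gamma_x$ is the index of the first nonzero entry of $x$. $F_1=\{x\in\mathbb{R}^m:\|x\|_0\le s,\ e_{\gamma_x}^\top x=1\}$ (nonzero vectors with at most $s$ nonzero entries and first nonzero entry equal to $1$), $F_2=\{y\in\mathbb{R}^n:\|y\|_0\le t\}$, $F=F_1\times F_2$. Bouligand tangent cone: for nonempty $S\subseteq\mathbb{R}^p$, $x\in S$, $T^B_S(x)$ is the set of $d$ for which there exist $\{x^k\}\subset S$, $x^k\to x$, and $\lambda_k\ge0$ with $\lambda_k(x^k-x)\to d$. $z^*\in F$ is a $T^B$-stationary point if $\|\nabla^B_F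 f(z^* )\|=0$, where $\nabla^B_Ff(z^* ):=\mathrm{argmin}\{\|\nabla f(z^* )+d\|: d\in T^B_F(z^* )\}$ (i.e. the minimizer is $d=0$). *)

theory Defs
  imports "HOL-Analysis.Analysis"
begin

text \<open>
  A finite linearly ordered index type stands for \<open>{1..m}\<close> (respectively \<open>{1..n}\<close>), and
  \<open>\<real>\<^sup>m\<^sup>+\<^sup>n\<close> is the product \<open>real^'m \<times> real^'n\<close>, whose library norm and inner product are the
  Euclidean ones.  The coordinates of \<open>z = (x, y)\<close> are indexed by \<open>'m + 'n\<close>:  \<open>Inl j\<close> is the
  \<open>j\<close>-th coordinate of \<open>x\<close> and \<open>Inr k\<close> the \<open>k\<close>-th coordinate of \<open>y\<close>.
\<close>

fun coord :: "(real^'m) \<times> (real^'n) \<Rightarrow> 'm + 'n \<Rightarrow> real" where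
  "coord (x, y) (Inl j) = x $ j"
| "coord (x, y) (Inr k) = y $ k"

definition I1 :: "('m + 'n) set" where
  "I1 = range Inl"

definition I2 :: "('m + 'n) set" where
  "I2 = range Inr"

text \<open>The order of \<open>{1..m+n}\<close>: the coordinates of \<open>x\<close> come before those of \<open>y\<close>.\<close>

fun idx_less :: "'m::linorder + 'n::linorder \<Rightarrow> 'm + 'n \<Rightarrow> bool" where
  "idx_less (Inl j) (Inl j') \<longleftrightarrow> j < j'"
| "idx_less (Inl j) (Inr k) \<longleftrightarrow> True"
| "idx_less (Inr k) (Inl j) \<longleftrightarrow> False"
| "idx_less (Inr k) (Inr k') \<longleftrightarrow> k < k'"

definition nnz :: "real^'m \<Rightarrow> nat" where
  "nnz x = card {j. x $ j \<noteq> 0}"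

text \<open>Meaningful only for \<open>x \<noteq> 0\<close>.\<close>

definition first_nz :: "real^('m::{finite,linorder}) \<Rightarrow> 'm" where
  "first_nz x = Min {j. x $ j \<noteq> 0}"

definition tensor_apply ::
    "real^'n^'m^'l \<Rightarrow> real^'m \<Rightarrow> real^'n \<Rightarrow> real^'l" where
  "tensor_apply A x y = (\<chi> i. \<Sum>j\<in>UNIV. \<Sum>k\<in>UNIV. A $ i $ j $ k * x $ j * y $ k)"

definition objective ::
    "real^'n^'m^'l \<Rightarrow> real^'l \<Rightarrow> (real^'m) \<times> (real^'n) \<Rightarrow> real" where
  "objective A b z = 1/2 * (norm (tensor_apply A (fst z) (snd z) - b))\<^sup>2"

definition feasible1 :: "nat \<Rightarrow> (real^('m::{finite,linorder})) set" where
  "feasible1 s = {x. x \<noteq> 0 \<and> nnz x \<le> s \<and> x $ first_nz x = 1}"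

definition feasible2 :: "nat \<Rightarrow> (real^'n) set" where
  "feasible2 t = {y. nnz y \<le> t}"

definition feasible ::
    "nat \<Rightarrow> nat \<Rightarrow> ((real^('m::{finite,linorder})) \<times> (real^'n)) set" where
  "feasible s t = feasible1 s \<times> feasible2 t"

definition gradient :: "('a::real_inner \<Rightarrow> real) \<Rightarrow> 'a \<Rightarrow> 'a" where
  "gradient f z = (THE g. GDERIV f z :> g)"

definition bouligand_cone :: "'a::real_normed_vector set \<Rightarrow> 'a \<Rightarrow> 'a set" where
  "bouligand_cone S x =
     {d. \<exists>(X :: nat \<Rightarrow> 'a) (c :: nat \<Rightarrow> real).
           (\<forall>k. X k \<in> S) \<and> X \<longlonglongrightarrow> x \<and> (\<forall>k. 0 \<le> c k) \<and>
           (\<lambda>k. c k *\<^sub>R (X k - x)) \<longlonglongrightarrow> d}"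

text \<open>The cone need not be convex, so the argmin is a set of vectors.\<close>

definition bouligand_gradient :: "('a::real_inner \<Rightarrow> real) \<Rightarrow> 'a set \<Rightarrow> 'a \<Rightarrow> 'a set" where
  "bouligand_gradient f S z =
     {d. is_arg_min (\<lambda>d. norm (gradient f z + d)) (\<lambda>d. d \<in> bouligand_cone S z) d}"

definition TB_stationary :: "('a::real_inner \<Rightarrow> real) \<Rightarrow> 'a set \<Rightarrow> 'a \<Rightarrow> bool" where
  "TB_stationary f S z \<longleftrightarrow> z \<in> S \<and> bouligand_gradient f S z = {0}"

definition supp :: "(real^'m) \<times> (real^'n) \<Rightarrow> ('m + 'n) set" where
  "supp z = {i. coord z i \<noteq> 0}"

definition supp1 :: "(real^'m) \<times> (real^'n) \<Rightarrow> ('m + 'n) set" where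
  "supp1 z = supp z \<inter> I1"

definition supp2 :: "(real^'m) \<times> (real^'n) \<Rightarrow> ('m + 'n) set" where
  "supp2 z = supp z \<inter> I2"

definition pivot :: "(real^('m::{finite,linorder})) \<times> (real^'n) \<Rightarrow> 'm + 'n" where
  "pivot z = Inl (first_nz (fst z))"

definition partial ::
    "((real^'m) \<times> (real^'n) \<Rightarrow> real) \<Rightarrow> 'm + 'n \<Rightarrow> (real^'m) \<times> (real^'n) \<Rightarrow> real" where
  "partial f i z = coord (gradient f z) i"

end

theory Submission
  imports Defs
begin

text \<open>
  Write \<open>g\<close> for the gradient at \<open>z\<close>.  If a whole line \<open>z + \<real> e\<close> lies in the feasible set, then
  \<open>\<real> e\<close> lies in the Bouligand cone, and minimality of \<open>0\<close> for \<open>\<parallel>g + d\<parallel>\<close> on that line forces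
  \<open>g \<bullet> e = 0\<close>.  Conversely, if \<open>g\<close> is orthogonal to the whole cone, Pythagoras gives
  \<open>\<parallel>g + d\<parallel>\<^sup>2 = \<parallel>g\<parallel>\<^sup>2 + \<parallel>d\<parallel>\<^sup>2\<close>, so \<open>0\<close> is the unique minimizer.  Stationarity is therefore the
  vanishing of \<open>g\<close> on a set of coordinates as soon as the lines in these coordinate directions
  stay feasible and the cone lies in their span; this is
  \<open>TB_stationary_iff_free_coordinates\<close>.

  It remains to find the free coordinates.  A point of \<open>F\<close> close to \<open>z\<close> has at least the nonzero
  coordinates of \<open>z\<close>, and therefore exactly these in a factor where the sparsity bound is
  attained.  The normalization also fixes the pivot: if new nonzero entries appeared before it,
  the first of them would have to be small and equal to \<open>1\<close> at once.  So the entries of \<open>x\<close> up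
  to the pivot are locally constant on \<open>F\<close>.  Each coordinate not fixed in one of these two ways
  can be varied on its own within \<open>F\<close>.  Only the vector \<open>g\<close> enters, so the equivalence holds
  for every objective function (\<open>TB_stationary_feasible_iff\<close>); the cone is in general a union
  of subspaces and not itself a subspace.
\<close>

section \<open>Stationarity from feasible lines\<close>

lemma line_subset_imp_in_bouligand_cone:
  fixes z e :: "'a::real_normed_vector"
  assumes "\<And>r. z + r *\<^sub>R e \<in> S"
  shows "r *\<^sub>R e \<in> bouligand_cone S z"
proof -
  define X where "X k = z + (r / real (Suc k)) *\<^sub>R e" for k
  have "(\<lambda>k. r / real (Suc k)) \<longlonglongrightarrow> 0"
    using tendsto_mult_right_zero[OF LIMSEQ_inverse_real_of_nat, of r]
    by (simp add: divide_inverse)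
  then have "X \<longlonglongrightarrow> z + 0 *\<^sub>R e"
    unfolding X_def by (intro tendsto_intros)
  moreover have "(\<lambda>k. real (Suc k) *\<^sub>R (X k - z)) = (\<lambda>k. r *\<^sub>R e)"
    by (simp add: X_def del: of_nat_Suc)
  moreover have "X k \<in> S" for k
    using assms by (simp add: X_def)
  ultimately show ?thesis
    unfolding bouligand_cone_def
    by (intro CollectI exI[of _ X] exI[of _ "\<lambda>k. real (Suc k)"]) auto
qed

text \<open>
  In a coordinate that is constant along every feasible sequence with limit \<open>z\<close>, the difference
  quotients that define a tangent vector are eventually zero.
\<close>

lemma bouligand_cone_inner_eq_0:
  assumes "d \<in> bouligand_cone S z"
    and "\<And>X. (\<And>k. X k \<in> S) \<Longrightarrow> X \<longlonglongrightarrow> z \<Longrightarrow> \<forall>\<^sub>F k in sequentially. X k \<bullet> i = z \<bullet> i"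
  shows "d \<bullet> i = 0"
proof -
  obtain X c where X: "\<And>k. X k \<in> S" "X \<longlonglongrightarrow> z"
    and lim: "(\<lambda>k. c k *\<^sub>R (X k - z)) \<longlonglongrightarrow> d"
    using assms(1) unfolding bouligand_cone_def by blast
  have "(\<lambda>k. (c k *\<^sub>R (X k - z)) \<bullet> i) \<longlonglongrightarrow> d \<bullet> i"
    using lim by (intro tendsto_intros)
  moreover have "\<forall>\<^sub>F k in sequentially. (c k *\<^sub>R (X k - z)) \<bullet> i = 0"
    using assms(2)[OF X] by eventually_elim (simp add: inner_diff_left)
  then have "(\<lambda>k. (c k *\<^sub>R (X k - z)) \<bullet> i) \<longlonglongrightarrow> 0"
    by (rule tendsto_eventually)
  ultimately show ?thesis
    by (rule LIMSEQ_unique)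
qed

lemma line_minimum_imp_orthogonal:
  fixes g e :: "'a::real_inner"
  assumes "\<And>r. norm g \<le> norm (g + r *\<^sub>R e)"
  shows "g \<bullet> e = 0"
proof (cases "e = 0")
  case False
  \<comment> \<open>The parameter of the point of the line nearest to the origin.\<close>
  define r where "r = - (g \<bullet> e) / (e \<bullet> e)"
  have "(norm g)\<^sup>2 \<le> (norm (g + r *\<^sub>R e))\<^sup>2"
    using assms by (intro power_mono) auto
  also have "\<dots> = (norm g)\<^sup>2 + 2 * r * (g \<bullet> e) + r\<^sup>2 * (e \<bullet> e)"
    unfolding power2_norm_eq_inner
    by (simp add: inner_add_left inner_add_right inner_commute power2_eq_square)
  also have "\<dots> = (norm g)\<^sup>2 - (g \<bullet> e)\<^sup>2 / (e \<bullet> e)"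
    using False by (simp add: r_def power2_eq_square field_simps)
  finally have "(g \<bullet> e)\<^sup>2 / (e \<bullet> e) \<le> 0"
    by simp
  then have "(g \<bullet> e)\<^sup>2 \<le> 0"
    using False inner_gt_zero_iff[of e] by (auto simp: divide_le_0_iff not_le[symmetric])
  then show ?thesis
    by simp
qed simp

lemma TB_stationary_line_imp_orthogonal:
  assumes "TB_stationary f S z" and "\<And>r. z + r *\<^sub>R e \<in> S"
  shows "gradient f z \<bullet> e = 0"
proof (rule line_minimum_imp_orthogonal)
  fix r
  have "0 \<in> bouligand_gradient f S z"
    using assms(1) by (simp add: TB_stationary_def)
  then show "norm (gradient f z) \<le> norm (gradient f z + r *\<^sub>R e)"
    using line_subset_imp_in_bouligand_cone[OF assms(2), of r]
    by (auto simp: bouligand_gradient_def is_arg_min_linorder)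
qed

lemma orthogonal_bouligand_cone_imp_TB_stationary:
  assumes "z \<in> S" and orth: "\<And>d. d \<in> bouligand_cone S z \<Longrightarrow> gradient f z \<bullet> d = 0"
  shows "TB_stationary f S z"
proof -
  let ?g = "gradient f z" and ?T = "bouligand_cone S z"
  have zero: "0 \<in> ?T"
    unfolding bouligand_cone_def using assms(1)
    by (intro CollectI exI[of _ "\<lambda>_. z"] exI[of _ "\<lambda>_. 0"]) auto
  have pyth: "(norm (?g + d))\<^sup>2 = (norm ?g)\<^sup>2 + (norm d)\<^sup>2" if "d \<in> ?T" for d
    using orth[OF that] unfolding power2_norm_eq_inner
    by (simp add: inner_add_left inner_add_right inner_commute)
  have "norm ?g \<le> norm (?g + d)" if "d \<in> ?T" for d
    by (rule power2_le_imp_le) (simp_all add: pyth[OF that])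
  moreover have "d = 0" if "d \<in> ?T" "norm (?g + d) \<le> norm ?g" for d
  proof -
    have "(norm (?g + d))\<^sup>2 \<le> (norm ?g)\<^sup>2"
      using that(2) by (intro power_mono) auto
    then show ?thesis
      using pyth[OF that(1)] by simp
  qed
  ultimately have "bouligand_gradient f S z = {0}"
    using zero unfolding bouligand_gradient_def is_arg_min_linorder by fastforce
  then show ?thesis
    using assms(1) by (simp add: TB_stationary_def)
qed

text \<open>
  The line condition gives a lower bound on the cone and the rigidity condition an upper bound.
  The lower bound consists of the coordinate axes in \<open>J\<close> only, yet both bounds have the same
  orthogonal complement, which is all that stationarity sees.
\<close>

lemma TB_stationary_iff_free_coordinates:
  fixes z :: "'a::euclidean_space"
  assumes "z \<in> S"
    and lines: "\<And>i r. i \<in> J \<Longrightarrow> z + r *\<^sub>R i \<in> S"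
    and rigid: "\<And>X i. i \<in> Basis - J \<Longrightarrow> (\<And>k. X k \<in> S) \<Longrightarrow> X \<longlonglongrightarrow> z \<Longrightarrow>
      \<forall>\<^sub>F k in sequentially. X k \<bullet> i = z \<bullet> i"
  shows "TB_stationary f S z \<longleftrightarrow> (\<forall>i\<in>J. gradient f z \<bullet> i = 0)"
proof
  assume "TB_stationary f S z"
  then show "\<forall>i\<in>J. gradient f z \<bullet> i = 0"
    using TB_stationary_line_imp_orthogonal lines by blast
next
  assume vanish: "\<forall>i\<in>J. gradient f z \<bullet> i = 0"
  show "TB_stationary f S z"
  proof (rule orthogonal_bouligand_cone_imp_TB_stationary[OF assms(1)])
    fix d assume d: "d \<in> bouligand_cone S z"
    have "(gradient f z \<bullet> i) * (d \<bullet> i) = 0" if "i \<in> Basis" for i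
      using vanish bouligand_cone_inner_eq_0[OF d rigid] that by (cases "i \<in> J") auto
    then show "gradient f z \<bullet> d = 0"
      by (subst euclidean_inner) (auto intro: sum.neutral)
  qed
qed

section \<open>Sparse and normalized vectors\<close>

lemma nnz_line_le:
  "nnz (x + axis j r) \<le> card (insert j {i. x $ i \<noteq> 0})"
  unfolding nnz_def by (rule card_mono) (auto simp: axis_def)

lemma eventually_nonzeros_subset:
  fixes x :: "real^'m"
  assumes "X \<longlonglongrightarrow> x"
  shows "\<forall>\<^sub>F k in sequentially. {j. x $ j \<noteq> 0} \<subseteq> {j. X k $ j \<noteq> 0}"
proof -
  have "\<forall>\<^sub>F k in sequentially. x $ j \<noteq> 0 \<longrightarrow> X k $ j \<noteq> 0" for j
    using tendsto_imp_eventually_ne[OF tendsto_vec_nth[OF assms, of j], of 0]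
    by (cases "x $ j = 0") (auto elim: eventually_mono)
  then have "\<forall>\<^sub>F k in sequentially. \<forall>j. x $ j \<noteq> 0 \<longrightarrow> X k $ j \<noteq> 0"
    by (rule eventually_all_finite)
  then show ?thesis
    by eventually_elim blast
qed

text \<open>
  Where the sparsity bound is attained there is no room for a nonzero entry besides those
  that persist by continuity.
\<close>

lemma eventually_zero_if_sparsity_attained:
  assumes "X \<longlonglongrightarrow> x" and "\<And>k. nnz (X k) \<le> nnz x" and "x $ j = 0"
  shows "\<forall>\<^sub>F k in sequentially. X k $ j = 0"
  using eventually_nonzeros_subset[OF assms(1)]
proof eventually_elim
  case (elim k)
  then have "{j. x $ j \<noteq> 0} = {j. X k $ j \<noteq> 0}"
    using assms(2)[of k] unfolding nnz_def by (intro card_seteq) auto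
  then show ?case
    using assms(3) by blast
qed

lemma first_nz_eqI:
  assumes "x $ p \<noteq> 0" and "\<And>j. j < p \<Longrightarrow> x $ j = 0"
  shows "first_nz x = p"
  unfolding first_nz_def
proof (rule Min_eqI)
  show "p \<le> j" if "j \<in> {j. x $ j \<noteq> 0}" for j
    using assms(2)[of j] that by (meson mem_Collect_eq not_le_imp_less)
qed (use assms(1) in auto)

lemma first_nz_le: "x $ j \<noteq> 0 \<Longrightarrow> first_nz x \<le> j"
  unfolding first_nz_def by simp

lemma zero_before_first_nz: "j < first_nz x \<Longrightarrow> x $ j = 0"
  using first_nz_le leD by blast

text \<open>
  The first nonzero entry of a nearby feasible vector is \<open>1\<close>, so it cannot sit where \<open>x\<close>
  vanishes.  As the pivot of \<open>x\<close> stays nonzero, it stays the pivot.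
\<close>

lemma eventually_first_nz_eq:
  assumes "\<And>k. X k \<in> feasible1 s" and "X \<longlonglongrightarrow> x" and "x \<in> feasible1 s"
  shows "\<forall>\<^sub>F k in sequentially. first_nz (X k) = first_nz x"
proof -
  let ?p = "first_nz x"
  have "\<forall>\<^sub>F k in sequentially. j < ?p \<longrightarrow> X k $ j \<noteq> 1" for j
    using tendsto_imp_eventually_ne[OF tendsto_vec_nth[OF assms(2), of j], of 1]
      zero_before_first_nz[of j x]
    by (cases "j < ?p") (auto elim: eventually_mono)
  then have "\<forall>\<^sub>F k in sequentially. \<forall>j. j < ?p \<longrightarrow> X k $ j \<noteq> 1"
    by (rule eventually_all_finite)
  then show ?thesis
    using eventually_nonzeros_subset[OF assms(2)]
  proof eventually_elim
    case (elim k)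
    have "x $ ?p \<noteq> 0"
      using assms(3) by (simp add: feasible1_def)
    then have "first_nz (X k) \<le> ?p"
      using elim(2) by (blast intro: first_nz_le)
    moreover have "X k $ first_nz (X k) = 1"
      using assms(1) by (simp add: feasible1_def)
    ultimately show ?case
      using elim(1) by (metis order_le_less)
  qed
qed

section \<open>The free coordinates\<close>

text \<open>
  The indices whose entry alone can be changed at will within the factor of the feasible set:
  all when there is room for one more nonzero entry, only the nonzero entries otherwise; in the
  first factor they have to come after the pivot.
\<close>

definition free1 :: "nat \<Rightarrow> real^('m::{finite,linorder}) \<Rightarrow> 'm set" where
  "free1 s x = (if nnz x < s then {first_nz x<..} else {j. x $ j \<noteq> 0} - {first_nz x})"

definition free2 :: "nat \<Rightarrow> real^'n \<Rightarrow> 'n set" where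
  "free2 t y = (if nnz y < t then UNIV else {k. y $ k \<noteq> 0})"

text \<open>
  A free index lies strictly after the pivot, so moving along its axis changes neither the pivot
  nor the normalization.
\<close>

lemma feasible1_line:
  assumes "x \<in> feasible1 s" and "j \<in> free1 s x"
  shows "x + axis j r \<in> feasible1 s"
proof -
  let ?p = "first_nz x" and ?x = "x + axis j r"
  have j: "?p < j"
    using assms(2) first_nz_le[of x j] by (auto simp: free1_def split: if_splits)
  have p: "?x $ ?p = 1"
    using assms(1) j by (simp add: feasible1_def axis_def)
  have "first_nz ?x = ?p"
    using p j zero_before_first_nz[of _ x] by (intro first_nz_eqI) (auto simp: axis_def)
  moreover have "card (insert j {i. x $ i \<noteq> 0}) \<le> s"
    using assms unfolding free1_def feasible1_def nnz_def
    by (auto simp: card_insert_if insert_absorb split: if_splits)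
  then have "nnz ?x \<le> s"
    using nnz_line_le order_trans by blast
  moreover have "?x \<noteq> 0"
    using p by (metis zero_index zero_neq_one)
  ultimately show ?thesis
    using p by (simp add: feasible1_def)
qed

lemma feasible2_line:
  assumes "y \<in> feasible2 t" and "k \<in> free2 t y"
  shows "y + axis k r \<in> feasible2 t"
proof -
  have "card (insert k {i. y $ i \<noteq> 0}) \<le> t"
    using assms unfolding free2_def feasible2_def nnz_def
    by (auto simp: card_insert_if insert_absorb split: if_splits)
  then show ?thesis
    using nnz_line_le order_trans unfolding feasible2_def by blast
qed

lemma feasible1_rigid:
  assumes "\<And>k. X k \<in> feasible1 s" and "X \<longlonglongrightarrow> x" and "x \<in> feasible1 s" and "j \<notin> free1 s x"
  shows "\<forall>\<^sub>F k in sequentially. X k $ j = x $ j"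
proof (cases "first_nz x < j")
  case True
  then have "nnz x = s" "x $ j = 0"
    using assms(3,4) by (auto simp: free1_def feasible1_def split: if_splits)
  then show ?thesis
    using eventually_zero_if_sparsity_attained[OF assms(2), of j] assms(1)
    by (simp add: feasible1_def)
next
  case False
  show ?thesis
    using eventually_first_nz_eq[OF assms(1-3)]
  proof eventually_elim
    case (elim k)
    show ?case
    proof (cases "j = first_nz x")
      case True
      then show ?thesis
        using elim assms(1)[of k] assms(3) by (simp add: feasible1_def)
    next
      case neq: False
      then have "j < first_nz x"
        using False by simp
      then show ?thesis
        using elim by (simp add: zero_before_first_nz)
    qed
  qed
qed

lemma feasible2_rigid:
  assumes "\<And>k. Y k \<in> feasible2 t" and "Y \<longlonglongrightarrow> y" and "y \<in> feasible2 t" and "j \<notin> free2 t y"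
  shows "\<forall>\<^sub>F k in sequentially. Y k $ j = y $ j"
proof -
  have "nnz y = t" "y $ j = 0"
    using assms(3,4) by (auto simp: free2_def feasible2_def split: if_splits)
  then show ?thesis
    using eventually_zero_if_sparsity_attained[OF assms(2), of j] assms(1)
    by (simp add: feasible2_def)
qed

section \<open>Stationarity on the product\<close>

fun unit_vector :: "'m + 'n \<Rightarrow> (real^'m) \<times> (real^'n)" where
  "unit_vector (Inl j) = (axis j 1, 0)"
| "unit_vector (Inr k) = (0, axis k 1)"

lemma inner_unit_vector: "z \<bullet> unit_vector i = coord z i"
  by (cases z; cases i) (auto simp: inner_axis)

lemma Basis_eq_range_unit_vector: "Basis = range unit_vector"
  by (auto simp: Basis_prod_def Basis_vec_def image_iff)
    (metis unit_vector.simps sumE)+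

lemma coord_Inl: "coord z (Inl j) = fst z $ j"
  by (cases z) simp

lemma coord_Inr: "coord z (Inr k) = snd z $ k"
  by (cases z) simp

lemma TB_stationary_feasible_iff:
  fixes x :: "real^('m::{finite,linorder})" and y :: "real^'n"
  assumes "(x, y) \<in> feasible s t"
  shows "TB_stationary f (feasible s t) (x, y) \<longleftrightarrow>
    (\<forall>i \<in> free1 s x <+> free2 t y. partial f i (x, y) = 0)"
proof -
  let ?I = "free1 s x <+> free2 t y"
  have xy: "x \<in> feasible1 s" "y \<in> feasible2 t"
    using assms by (auto simp: feasible_def)
  have "TB_stationary f (feasible s t) (x, y) \<longleftrightarrow>
    (\<forall>e \<in> unit_vector ` ?I. gradient f (x, y) \<bullet> e = 0)"
  proof (rule TB_stationary_iff_free_coordinates[OF assms])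
    have scale: "r *\<^sub>R axis j 1 = axis j r" for r :: real and j
      by (simp add: vec_eq_iff axis_def)
    show "(x, y) + r *\<^sub>R e \<in> feasible s t" if "e \<in> unit_vector ` ?I" for e r
      using that xy feasible1_line[OF xy(1)] feasible2_line[OF xy(2)]
      by (auto simp: feasible_def scale)
  next
    fix X e
    assume e: "e \<in> Basis - unit_vector ` ?I"
      and X: "\<And>k. X k \<in> feasible s t" "X \<longlonglongrightarrow> (x, y)"
    obtain i where i: "e = unit_vector i" "i \<notin> ?I"
      using e by (auto simp: Basis_eq_range_unit_vector)
    have fst: "fst (X k) \<in> feasible1 s" and snd: "snd (X k) \<in> feasible2 t" for k
      using X(1)[of k] by (auto simp: feasible_def)
    have limits: "(\<lambda>k. fst (X k)) \<longlonglongrightarrow> x" "(\<lambda>k. snd (X k)) \<longlonglongrightarrow> y"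
      using tendsto_fst[OF X(2)] tendsto_snd[OF X(2)] by simp_all
    have "\<forall>\<^sub>F k in sequentially. coord (X k) i = coord (x, y) i"
      using i(2) feasible1_rigid[OF fst limits(1) xy(1)]
        feasible2_rigid[OF snd limits(2) xy(2)]
      by (cases i) (auto simp: coord_Inl coord_Inr)
    then show "\<forall>\<^sub>F k in sequentially. X k \<bullet> e = (x, y) \<bullet> e"
      by (simp add: i(1) inner_unit_vector)
  qed
  then show ?thesis
    by (simp add: inner_unit_vector partial_def)
qed

lemma supp_pair: "supp (x, y) = {j. x $ j \<noteq> 0} <+> {k. y $ k \<noteq> 0}"
proof -
  have "i \<in> supp (x, y) \<longleftrightarrow> i \<in> {j. x $ j \<noteq> 0} <+> {k. y $ k \<noteq> 0}" for i
    by (cases i) (auto simp: supp_def)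
  then show ?thesis
    by blast
qed

lemma supp1_pair: "supp1 (x, y) = Inl ` {j. x $ j \<noteq> 0}"
  by (auto simp: supp1_def supp_pair I1_def)

lemma supp2_pair: "supp2 (x, y) = Inr ` {k. y $ k \<noteq> 0}"
  by (auto simp: supp2_def supp_pair I2_def)

lemma card_supp1: "card (supp1 (x, y)) = nnz x"
  by (simp add: supp1_pair nnz_def card_image)

lemma card_supp2: "card (supp2 (x, y)) = nnz y"
  by (simp add: supp2_pair nnz_def card_image)

lemma idx_less_pivot_set:
  "{i. idx_less (pivot (x, y)) i} = {first_nz x<..} <+> UNIV"
proof -
  have "idx_less (pivot (x, y)) i \<longleftrightarrow> i \<in> {first_nz x<..} <+> UNIV" for i
    by (cases i) (auto simp: pivot_def)
  then show ?thesis
    by blast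
qed

theorem theorem3p4:
  fixes A :: "real^('n::{finite,linorder})^('m::{finite,linorder})^('l::finite)"
    and b :: "real^'l"
    and s t :: nat
    and z :: "(real^('m::{finite,linorder})) \<times> (real^('n::{finite,linorder}))"
  assumes "0 < s" and "s < CARD('m)"
    and "0 < t" and "t < CARD('n)"
    and "z \<in> feasible s t"
  shows "TB_stationary (objective A b) (feasible s t) z \<longleftrightarrow>
    (card (supp1 z) = s \<and> card (supp2 z) = t \<longrightarrow>
       (\<forall>i \<in> supp z - {pivot z}. partial (objective A b) i z = 0)) \<and>
    (card (supp1 z) = s \<and> card (supp2 z) < t \<longrightarrow>
       (\<forall>i \<in> (supp1 z - {pivot z}) \<union> I2. partial (objective A b) i z = 0)) \<and>
    (card (supp1 z) < s \<and> card (supp2 z) = t \<longrightarrow>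
       (\<forall>i \<in> {i \<in> I1. idx_less (pivot z) i} \<union> supp2 z. partial (objective A b) i z = 0)) \<and>
    (card (supp1 z) < s \<and> card (supp2 z) < t \<longrightarrow>
       (\<forall>i. idx_less (pivot z) i \<longrightarrow> partial (objective A b) i z = 0))"
proof -
  obtain x y where z: "z = (x, y)"
    by (cases z)
  have bounds: "nnz x \<le> s" "nnz y \<le> t"
    using assms(5) by (auto simp: z feasible_def feasible1_def feasible2_def)
  let ?free = "free1 s x <+> free2 t y"
  have "?free = supp z - {pivot z}" if "nnz x = s" "nnz y = t"
    using that by (auto simp: z free1_def free2_def supp_pair pivot_def)
  moreover have "?free = (supp1 z - {pivot z}) \<union> I2" if "nnz x = s" "nnz y < t"
    using that by (auto simp: z free1_def free2_def supp1_pair I2_def pivot_def)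
  moreover have "?free = {i \<in> I1. idx_less (pivot z) i} \<union> supp2 z" if "nnz x < s" "nnz y = t"
    using that by (auto simp: z free1_def free2_def supp2_pair I1_def pivot_def)
  moreover have "?free = {i. idx_less (pivot z) i}" if "nnz x < s" "nnz y < t"
    using that by (simp add: z free1_def free2_def idx_less_pivot_set)
  moreover have "TB_stationary (objective A b) (feasible s t) z \<longleftrightarrow>
      (\<forall>i \<in> ?free. partial (objective A b) i z = 0)"
    using TB_stationary_feasible_iff assms(5) unfolding z by blast
  moreover have "card (supp1 z) = nnz x" "card (supp2 z) = nnz y"
    by (simp_all add: z card_supp1 card_supp2)
  ultimately show ?thesis
    using bounds by (cases "nnz x = s"; cases "nnz y = t") simp_all
qed

end
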